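(* Let $p>2$ be a prime and let $\mathbb{K}$ be a field of characteristic $p$. Then there exist elements $A(x,y)$ and $B(x,y)$ of the free Lie algebra $\mathfrak{lie}_2$ over $\mathbb{K}$ on $x,y$ such that $$[x,A(x,y)]+[y,B(x,y)]=x^p+y^p-(x+y)^p$$ and $$\mathrm{tr}(x\,\partial_x A+y\,\partial_y B)=\frac{1}{2}\,\mathrm{tr}\bigl(x^{p-1}+y^{p-1}-(x+y)^{p-1}\bigr),$$ where $\mathrm{tr}$ is the projection onto circular words modulo the relations identifying $a$ with $a^T$, as defined in the context.
   Context: $\mathfrak{lie}_2=\prod_{k\ge 1}\mathfrak{lie}_2^k$ denotes the (degree-completed) free Lie algebra over $\mathbb{K}$ with generators $x,y$, where $\mathfrak{lie}_2^k$ is spanned by the Lie words consisting of $k$ letters. $\mathrm{Assoc}_2$ denotes the (degree-completed) free unital associative $\mathbb{K}$-algebra on $x,y$; it is the completed universal enveloping algebra of $\mathfrak{lie}_2$, and $\mathfrak{lie}_2$ is regarded as a subspace of $\mathrm{Assoc}_2$ via the natural injection. The element $x^p+y^p-(x+y)^p$ (the Jacobson element) lies in $\mathfrak{lie}_2$, and the first equation can be read in $\mathrm{Assoc}_2$. Every $a\in\mathrm{Assoc}_2$ has a unique presentation $a=a_0+a_1x+a_2y$ with $a_0\in\mathbb{K}$ and $a_1,a_2\in\mathrm{Assoc}_2$; put $\partial_x a=a_1$ and $\partial_y a=a_2$. Let $\mathrm{Assoc}_2^+=\prod_{k\ge1}\mathrm{Assoc}_2^k$ be the part of positive degree (where $\mathrm{Assoc}_2^k$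 is the homogeneous part of degree $k$). The space of circular words is $\mathfrak{tr}_2=\mathrm{Assoc}_2^+/\langle ab-ba : a,b\in\mathrm{Assoc}_2\rangle$, the quotient by the subspace spanned by commutators, with natural projection $\tilde{\mathrm{tr}}$. For a word $a=x_{i_1}\cdots x_{i_n}$ with each $x_{i_j}\in\{x,y\}$ put $a^T=(-x_{i_n})\cdots(-x_{i_1})$, extended linearly. The map $\mathrm{tr}$ is the composition of $\tilde{\mathrm{tr}}$ with the projection of $\mathfrak{tr}_2$ onto its quotient by the relations $\tilde{\mathrm{tr}}(a)=\tilde{\mathrm{tr}}(a^T)$ for all $a$. *)

theory Defs
  imports Complex_Main "HOL-Computational_Algebra.Primes"
begin

section \<open>The degree-completed free associative algebra on two generators\<close>

text \<open>A word is a list of letters, and an element of the completed algebra is an arbitrary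
  family of coefficients indexed by words, i.e. a noncommutative formal power series.\<close>

datatype letter = X | Y

typedef 'k assoc = "UNIV :: (letter list \<Rightarrow> 'k) set"
  morphisms coeff Assoc
  by simp

setup_lifting type_definition_assoc

lemma assoc_eq_iff: "a = b \<longleftrightarrow> (\<forall>w. coeff a w = coeff b w)"
  by (metis coeff_inject ext)

lemma assoc_eqI: "(\<And>w. coeff a w = coeff b w) \<Longrightarrow> a = b"
  by (simp add: assoc_eq_iff)

instantiation assoc :: (field) ring_1
begin

lift_definition zero_assoc :: "'a assoc" is "\<lambda>w. 0" .
lift_definition one_assoc :: "'a assoc" is "\<lambda>w. if w = [] then 1 else 0" .
lift_definition plus_assoc :: "'a assoc \<Rightarrow> 'a assoc \<Rightarrow> 'a assoc" is "\<lambda>a b w. a w + b w" .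
lift_definition minus_assoc :: "'a assoc \<Rightarrow> 'a assoc \<Rightarrow> 'a assoc" is "\<lambda>a b w. a w - b w" .
lift_definition uminus_assoc :: "'a assoc \<Rightarrow> 'a assoc" is "\<lambda>a w. - a w" .

text \<open>Bilinear and continuous extension of concatenation: sum over all ways to cut \<open>w\<close> in two.\<close>
lift_definition times_assoc :: "'a assoc \<Rightarrow> 'a assoc \<Rightarrow> 'a assoc" is
  "\<lambda>a b w. \<Sum>k\<le>length w. a (take k w) * b (drop k w)" .

instance
proof
  fix a b c :: "'a assoc"
  show "a * b * c = a * (b * c)"
  proof (transfer, rule ext)
    fix a b c :: "letter list \<Rightarrow> 'a" and w :: "letter list"
    let ?n = "length w"
    have "(\<Sum>k\<le>?n. (\<Sum>j\<le>length (take k w). a (take j (take k w)) * b (drop j (take k w))) * c (drop k w))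
        = (\<Sum>k\<le>?n. \<Sum>j\<le>k. a (take j w) * b (drop j (take k w)) * c (drop k w))"
      by (intro sum.cong refl) (auto simp: sum_distrib_right min_def intro!: sum.cong)
    also have "\<dots> = (\<Sum>(k,j)\<in>(SIGMA k:{..?n}. {..k}). a (take j w) * b (drop j (take k w)) * c (drop k w))"
      by (simp add: sum.Sigma)
    also have "\<dots> = (\<Sum>(j,i)\<in>(SIGMA j:{..?n}. {..?n - j}). a (take j w) * (b (take i (drop j w)) * c (drop i (drop j w))))"
      by (rule sum.reindex_bij_witness[where i = "\<lambda>(j,i). (j + i, j)" and j = "\<lambda>(k,j). (j, k - j)"])
         (auto simp: drop_take mult.assoc)
    also have "\<dots> = (\<Sum>j\<le>?n. a (take j w) * (\<Sum>i\<le>length (drop j w). b (take i (drop j w)) * c (drop i (drop j w))))"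
      by (simp add: sum.Sigma sum_distrib_left)
    finally show "(\<Sum>k\<le>?n. (\<Sum>j\<le>length (take k w). a (take j (take k w)) * b (drop j (take k w))) * c (drop k w))
      = (\<Sum>j\<le>?n. a (take j w) * (\<Sum>i\<le>length (drop j w). b (take i (drop j w)) * c (drop i (drop j w))))" .
  qed
  show "1 * a = a"
  proof (transfer, rule ext)
    fix a :: "letter list \<Rightarrow> 'a" and w :: "letter list"
    have "(\<Sum>k\<le>length w. (if take k w = [] then 1 else 0) * a (drop k w))
        = (\<Sum>k\<le>length w. if k = 0 then a w else 0)"
      by (intro sum.cong) auto
    then show "(\<Sum>k\<le>length w. (if take k w = [] then 1 else 0) * a (drop k w)) = a w"
      by simp
  qed
  show "a * 1 = a"
  proof (transfer, rule ext)
    fix a :: "letter list \<Rightarrow> 'a" and w :: "letter list"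
    have "(\<Sum>k\<le>length w. a (take k w) * (if drop k w = [] then 1 else 0))
        = (\<Sum>k\<le>length w. if k = length w then a w else 0)"
      by (intro sum.cong) auto
    then show "(\<Sum>k\<le>length w. a (take k w) * (if drop k w = [] then 1 else 0)) = a w"
      by simp
  qed
  show "(0 :: 'a assoc) \<noteq> 1"
    by transfer (auto simp: fun_eq_iff)
qed (transfer; simp add: fun_eq_iff algebra_simps sum.distrib)+

end

lift_definition scale :: "'k::field \<Rightarrow> 'k assoc \<Rightarrow> 'k assoc" is "\<lambda>c a w. c * a w" .

global_interpretation assoc: vector_space scale
  by unfold_locales (transfer; simp add: fun_eq_iff algebra_simps)+

lift_definition letter :: "letter \<Rightarrow> 'k::field assoc" is "\<lambda>l w. if w = [l] then 1 else 0" .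

abbreviation gen_x :: "'k::field assoc"  (\<open>\<^bold>x\<close>) where "\<^bold>x \<equiv> letter X"
abbreviation gen_y :: "'k::field assoc"  (\<open>\<^bold>y\<close>) where "\<^bold>y \<equiv> letter Y"

lemma coeff_simps [simp]:
  "coeff 0 w = 0" "coeff (a + b) w = coeff a w + coeff b w"
  "coeff (a - b) w = coeff a w - coeff b w" "coeff (- a) w = - coeff a w"
  "coeff (scale c a) w = c * coeff a w"
  by (transfer; simp)+

lemma coeff_one: "coeff 1 w = (if w = [] then 1 else 0)"
  by transfer simp

lemma coeff_letter: "coeff (letter l) w = (if w = [l] then 1 else 0)"
  by transfer simp

lemma coeff_mult: "coeff (a * b) w = (\<Sum>k\<le>length w. coeff a (take k w) * coeff b (drop k w))"
  by transfer simp

lemma coeff_mult_Nil [simp]: "coeff (a * b) [] = coeff a [] * coeff b []"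
  by (simp add: coeff_mult)

lemma coeff_mult_letter_Nil [simp]: "coeff (a * letter l) [] = 0" "coeff (letter l * a) [] = 0"
  by (simp_all add: coeff_letter)

lemma coeff_mult_letter_snoc [simp]:
  "coeff (a * letter l) (w @ [m]) = (if m = l then coeff a w else 0)"
proof -
  have "coeff (a * letter l) (w @ [m])
      = (\<Sum>k\<le>Suc (length w). if k = length w then (if m = l then coeff a w else 0) else 0)"
    unfolding coeff_mult
    by (rule sum.cong) (auto simp: coeff_letter Cons_eq_append_conv append_eq_Cons_conv le_Suc_eq)
  then show ?thesis by simp
qed


section \<open>The degree-completed free Lie algebra inside the associative algebra\<close>

definition lie_bracket :: "'k::field assoc \<Rightarrow> 'k assoc \<Rightarrow> 'k assoc"  (\<open>\<lbrakk>_,/ _\<rbrakk>\<close>) where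
  "\<lbrakk>a, b\<rbrakk> = a * b - b * a"

inductive lie_word :: "nat \<Rightarrow> 'k::field assoc \<Rightarrow> bool" where
  letter: "lie_word 1 (letter l)"
| bracket: "lie_word m a \<Longrightarrow> lie_word n b \<Longrightarrow> lie_word (m + n) \<lbrakk>a, b\<rbrakk>"

lift_definition hom_part :: "nat \<Rightarrow> 'k::field assoc \<Rightarrow> 'k assoc" is
  "\<lambda>k a w. if length w = k then a w else 0" .

text \<open>The product over \<open>k \<ge> 1\<close> of the spans of the Lie words with \<open>k\<close> letters, as a subspace of
  the associative algebra. There are no Lie words with \<open>0\<close> letters, so
  the case \<open>k = 0\<close> below says that the constant term vanishes.\<close>
definition lie2 :: "'k::field assoc set" where
  "lie2 = {a. \<forall>k. hom_part k a \<in> assoc.span {u. lie_word k u}}"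

lemma lie_word_pos: "lie_word k a \<Longrightarrow> k > 0"
  by (induction rule: lie_word.induct) auto

lemma hom_part_0_lie2: "a \<in> lie2 \<Longrightarrow> hom_part 0 a = 0"
proof -
  assume "a \<in> lie2"
  moreover have "{u :: 'a assoc. lie_word 0 u} = {}"
    using lie_word_pos by blast
  ultimately show ?thesis
    unfolding lie2_def by (metis (mono_tags) mem_Collect_eq assoc.span_empty singletonD)
qed


section \<open>The operators \<open>\<partial>\<^sub>x\<close> and \<open>\<partial>\<^sub>y\<close>\<close>

lift_definition strip_last :: "letter \<Rightarrow> 'k::field assoc \<Rightarrow> 'k assoc" is "\<lambda>l a w. a (w @ [l])" .

lemma coeff_strip_last [simp]: "coeff (strip_last l a) w = coeff a (w @ [l])"
  by transfer simp

lemma right_presentation_iff: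
  "a = scale a0 1 + a1 * \<^bold>x + a2 * \<^bold>y \<longleftrightarrow>
     a0 = coeff a [] \<and> a1 = strip_last X a \<and> a2 = strip_last Y a"
proof
  assume a: "a = scale a0 1 + a1 * \<^bold>x + a2 * \<^bold>y"
  show "a0 = coeff a [] \<and> a1 = strip_last X a \<and> a2 = strip_last Y a"
    by (intro conjI assoc_eqI) (subst a; simp add: coeff_one del: coeff_mult_Nil)+
next
  assume *: "a0 = coeff a [] \<and> a1 = strip_last X a \<and> a2 = strip_last Y a"
  show "a = scale a0 1 + a1 * \<^bold>x + a2 * \<^bold>y"
  proof (rule assoc_eqI)
    fix w
    show "coeff a w = coeff (scale a0 1 + a1 * \<^bold>x + a2 * \<^bold>y) w"
    proof (cases w rule: rev_cases)
      case Nil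
      then show ?thesis using * by (simp add: coeff_one del: coeff_mult_Nil)
    next
      case (snoc v m)
      then show ?thesis using * by (cases m) (simp_all add: coeff_one)
    qed
  qed
qed

definition partial_x :: "'k::field assoc \<Rightarrow> 'k assoc"  (\<open>\<partial>\<^sub>x\<close>) where
  "\<partial>\<^sub>x a = (THE a1. \<exists>a0 a2. a = scale a0 1 + a1 * \<^bold>x + a2 * \<^bold>y)"

definition partial_y :: "'k::field assoc \<Rightarrow> 'k assoc"  (\<open>\<partial>\<^sub>y\<close>) where
  "\<partial>\<^sub>y a = (THE a2. \<exists>a0 a1. a = scale a0 1 + a1 * \<^bold>x + a2 * \<^bold>y)"

lemma partial_x_eq: "\<partial>\<^sub>x a = strip_last X a"
  unfolding partial_x_def right_presentation_iff by (rule the_equality) auto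

lemma partial_y_eq: "\<partial>\<^sub>y a = strip_last Y a"
  unfolding partial_y_def right_presentation_iff by (rule the_equality) auto


section \<open>Circular words\<close>

definition assoc_plus :: "'k::field assoc set" where
  "assoc_plus = {a. coeff a [] = 0}"

lemma subspace_assoc_plus: "assoc.subspace assoc_plus"
  by (auto simp: assoc.subspace_def assoc_plus_def)

lemmas assoc_plus_closed =
  assoc.subspace_0[OF subspace_assoc_plus] assoc.subspace_add[OF subspace_assoc_plus]
  assoc.subspace_diff[OF subspace_assoc_plus] assoc.subspace_neg[OF subspace_assoc_plus]
  assoc.subspace_scale[OF subspace_assoc_plus]

abbreviation commutator_span :: "'k::field assoc set" where
  "commutator_span \<equiv> assoc.span {a * b - b * a | a b. True}"

lemma commutator_span_subset: "commutator_span \<subseteq> assoc_plus"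
  by (rule assoc.span_minimal[OF _ subspace_assoc_plus]) (auto simp: assoc_plus_def mult.commute)

definition tr2_rel :: "'k::field assoc \<Rightarrow> 'k assoc \<Rightarrow> bool" where
  "tr2_rel a b \<longleftrightarrow> a \<in> assoc_plus \<and> b \<in> assoc_plus \<and> a - b \<in> commutator_span"

quotient_type (overloaded) 'k tr2 = "'k::field assoc" / partial: tr2_rel
  morphisms rep_tr2 tr_tilde
proof (rule part_equivpI)
  show "\<exists>a::'k assoc. tr2_rel a a"
    by (rule exI[of _ 0]) (simp add: tr2_rel_def assoc_plus_closed assoc.span_zero)
  show "symp (tr2_rel :: 'k assoc \<Rightarrow> _)"
    by (rule sympI) (use assoc.span_neg in \<open>force simp: tr2_rel_def\<close>)
  show "transp (tr2_rel :: 'k assoc \<Rightarrow> _)"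
  proof (rule transpI)
    fix a b c :: "'k assoc"
    assume *: "tr2_rel a b" "tr2_rel b c"
    then have "(a - b) + (b - c) \<in> commutator_span"
      unfolding tr2_rel_def by (intro assoc.span_add) simp_all
    with * show "tr2_rel a c" by (simp add: tr2_rel_def)
  qed
qed

lemma tr_tilde_eq_iff:
  "a \<in> assoc_plus \<Longrightarrow> b \<in> assoc_plus \<Longrightarrow> tr_tilde a = tr_tilde b \<longleftrightarrow> a - b \<in> commutator_span"
  using Quotient3_rel[OF Quotient3_tr2, of a b]
  by (simp add: tr2_rel_def assoc.span_zero)

instantiation tr2 :: (field) ab_group_add
begin

lift_definition zero_tr2 :: "'a tr2" is 0
  by (simp add: tr2_rel_def assoc_plus_closed assoc.span_zero)

lift_definition plus_tr2 :: "'a tr2 \<Rightarrow> 'a tr2 \<Rightarrow> 'a tr2" is "(+)"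
  by (auto simp: tr2_rel_def add_diff_add intro: assoc.span_add assoc_plus_closed)

lift_definition uminus_tr2 :: "'a tr2 \<Rightarrow> 'a tr2" is uminus
  using assoc.span_neg by (force simp: tr2_rel_def intro: assoc_plus_closed)

definition minus_tr2 :: "'a tr2 \<Rightarrow> 'a tr2 \<Rightarrow> 'a tr2" where
  "minus_tr2 u v = u + - v"

instance
  by standard
     (unfold minus_tr2_def, (transfer; simp add: tr2_rel_def algebra_simps assoc_plus_closed assoc.span_zero)+)

end

lift_definition scale_tr2 :: "'k::field \<Rightarrow> 'k tr2 \<Rightarrow> 'k tr2" is scale
  by (auto simp: tr2_rel_def assoc.scale_right_diff_distrib[symmetric] intro: assoc.span_scale assoc_plus_closed)

global_interpretation tr2: vector_space scale_tr2
  by unfold_locales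
     (transfer; simp add: tr2_rel_def assoc.scale_right_distrib assoc.scale_left_distrib
        assoc_plus_closed assoc.span_zero)+


section \<open>Circular words modulo the anti-involution\<close>

text \<open>Extending \<open>a\<^sup>T = (-x\<^bsub>i\<^sub>n\<^esub>) \<cdots> (-x\<^bsub>i\<^sub>1\<^esub>)\<close> linearly, the coefficient of a word \<open>w\<close> in \<open>a\<^sup>T\<close> comes from
  the coefficient of the reversed word.\<close>
lift_definition transpose :: "'k::field assoc \<Rightarrow> 'k assoc"  (\<open>(_\<^sup>T)\<close> [1000] 999) is
  "\<lambda>a w. (- 1) ^ length w * a (rev w)" .

lemma coeff_transpose: "coeff (a\<^sup>T) w = (- 1) ^ length w * coeff a (rev w)"
  by transfer simp

lemma transpose_letter: "(letter l)\<^sup>T = - letter l"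
  by (rule assoc_eqI) (auto simp: coeff_transpose coeff_letter)

lemma transpose_in_assoc_plus: "a \<in> assoc_plus \<Longrightarrow> a\<^sup>T \<in> assoc_plus"
  by (simp add: assoc_plus_def coeff_transpose)

abbreviation transpose_span :: "'k::field tr2 set" where
  "transpose_span \<equiv> tr2.span {tr_tilde a - tr_tilde (a\<^sup>T) | a. a \<in> assoc_plus}"

definition tr2T_rel :: "'k::field tr2 \<Rightarrow> 'k tr2 \<Rightarrow> bool" where
  "tr2T_rel u v \<longleftrightarrow> u - v \<in> transpose_span"

quotient_type (overloaded) 'k tr2T = "'k::field tr2" / tr2T_rel
  morphisms rep_tr2T proj_tr2T
proof (rule equivpI)
  show "reflp (tr2T_rel :: 'k tr2 \<Rightarrow> _)"
    by (rule reflpI) (simp add: tr2T_rel_def tr2.span_zero)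
  show "symp (tr2T_rel :: 'k tr2 \<Rightarrow> _)"
    by (rule sympI) (use tr2.span_neg in \<open>force simp: tr2T_rel_def\<close>)
  show "transp (tr2T_rel :: 'k tr2 \<Rightarrow> _)"
  proof (rule transpI)
    fix a b c :: "'k tr2"
    assume *: "tr2T_rel a b" "tr2T_rel b c"
    then have "(a - b) + (b - c) \<in> transpose_span"
      unfolding tr2T_rel_def by (intro tr2.span_add) simp_all
    then show "tr2T_rel a c" by (simp add: tr2T_rel_def)
  qed
qed

lift_definition scale_tr2T :: "'k::field \<Rightarrow> 'k tr2T \<Rightarrow> 'k tr2T" is scale_tr2
  by (auto simp: tr2T_rel_def tr2.scale_right_diff_distrib[symmetric] intro: tr2.span_scale)

text \<open>Meaningful on \<open>assoc_plus\<close> only, like \<open>tr_tilde\<close>.\<close>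
definition tr :: "'k::field assoc \<Rightarrow> 'k tr2T" where
  "tr a = proj_tr2T (tr_tilde a)"

lemma tr_eq_iff: "tr a = tr b \<longleftrightarrow> tr_tilde a - tr_tilde b \<in> transpose_span"
  by (simp add: tr_def tr2T.abs_eq_iff tr2T_rel_def)

lemma tr_transpose: "a \<in> assoc_plus \<Longrightarrow> tr (a\<^sup>T) = tr a"
  by (rule sym) (auto simp: tr_eq_iff intro: tr2.span_base)

lemma scale_tr: "a \<in> assoc_plus \<Longrightarrow> scale_tr2T c (tr a) = tr (scale c a)"
  by (simp add: tr_def scale_tr2T.abs_eq scale_tr2.abs_eq tr2_rel_def assoc.span_zero)

end

theory Submission
  imports Defs
begin

text \<open>
  The solution is explicit. With a parameter \<open>t\<close> and \<open>u = t x + y\<close>, Jacobson's identity says that in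
  characteristic \<open>p\<close> the derivative of \<open>u ^ p\<close> with respect to \<open>t\<close> is
  \<open>ad(u) ^ (p - 1) (x) = t [x, v] + [y, v]\<close>, where \<open>v = ad(u) ^ (p - 2) (x)\<close>. Integrating from \<open>0\<close>
  to \<open>1\<close> suggests to take for \<open>A\<close> the integral of \<open>- t v\<close> and for \<open>B\<close> that of \<open>- v\<close>. The power of
  \<open>t\<close> at a word of \<open>v\<close> is one less than the number \<open>d\<close> of its letters \<open>x\<close>, so no parameter is
  needed: put \<open>t = 1\<close>, \<open>v = ad(x + y) ^ (p - 2) (x)\<close>, and obtain \<open>A\<close> and \<open>B\<close> from \<open>v\<close> by
  multiplying the coefficient of each word by \<open>- 1 / (d + 1)\<close> and \<open>- 1 / d\<close>. Lie words are
  homogeneous in each generator, so \<open>A\<close> and \<open>B\<close> are again Lie elements (\<open>weigh_lie_part\<close>).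

  Everything then follows from one formula: modulo \<open>p\<close>, the coefficient in \<open>v\<close> of a word of length
  \<open>p - 1\<close> is minus the sum of the positions, counted from \<open>1\<close>, of its letters \<open>x\<close>
  (\<open>coeff_ad_gens_char\<close>). Hence \<open>[x + y, v]\<close> has coefficient \<open>d\<close> at a word of length \<open>p\<close>
  (\<open>coeff_bracket_ad_gens_char\<close>). The weights of \<open>A\<close> and \<open>B\<close> are such that \<open>[x, A] + [y, B]\<close> has
  coefficient \<open>- d / d\<close>, that is \<open>- 1\<close>, except at the words \<open>x ^ p\<close> and \<open>y ^ p\<close>, where it is \<open>0\<close>. This
  is the Jacobson element.

  For the divergence equation, an element of degree \<open>n\<close> with \<open>n\<close> invertible is a sum of commutators
  as soon as its coefficients add up to \<open>0\<close> over the \<open>n\<close> rotations of every word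
  (\<open>commutator_spanI\<close>). For \<open>n = p - 1\<close> the sums are computed in \<open>sum_rotations\<close>; they are \<open>1 / 2\<close>
  unless all letters agree. The same holds for half of \<open>x ^ n + y ^ n - (x + y) ^ n\<close>, because
  \<open>n = - 1\<close> in the field. The two sides thus agree already as circular words, before
  \<open>a\<close> and \<open>a\<^sup>T\<close> are identified.
\<close>

section \<open>Coefficients of products with letters and of powers\<close>

lemma coeff_letter_mult_Cons [simp]:
  "coeff (letter l * a) (m # w) = (if m = l then coeff a w else 0)"
proof -
  have "coeff (letter l * a) (m # w)
      = (\<Sum>k\<le>Suc (length w). if k = Suc 0 then (if m = l then coeff a w else 0) else 0)"
    unfolding coeff_mult
  proof (rule sum.cong)
    fix k assume "k \<in> {..Suc (length w)}"
    show "coeff (letter l) (take k (m # w)) * coeff a (drop k (m # w)) =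
      (if k = Suc 0 then if m = l then coeff a w else 0 else 0)"
    proof (cases k)
      case (Suc i)
      then show ?thesis using \<open>k \<in> _\<close> by (cases i; cases w) (auto simp: coeff_letter)
    qed (simp add: coeff_letter)
  qed simp
  also have "\<dots> = (if m = l then coeff a w else 0)"
    by (subst sum.delta) simp_all
  finally show ?thesis .
qed

lemma coeff_gens_mult_Cons: "coeff ((\<^bold>x + \<^bold>y) * a) (m # w) = coeff a w"
  by (cases m) (simp_all add: distrib_right)

lemma coeff_mult_gens_snoc: "coeff (a * (\<^bold>x + \<^bold>y)) (w @ [m]) = coeff a w"
  by (cases m) (simp_all add: distrib_left)

lemma coeff_letter_power: "coeff (letter l ^ n) w = (if w = replicate n l then 1 else 0)"
proof (induction n arbitrary: w)
  case (Suc n)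
  show ?case by (cases w) (auto simp: Suc simp del: coeff_mult_Nil)
qed (simp add: coeff_one)

lemma coeff_gens_power: "coeff ((\<^bold>x + \<^bold>y) ^ n) w = (if length w = n then 1 else 0)"
proof (induction n arbitrary: w)
  case (Suc n)
  show ?case
    by (cases w) (auto simp: Suc coeff_gens_mult_Cons coeff_letter)
qed (simp add: coeff_one)

section \<open>Weighting by the degree in the first generator\<close>

text \<open>With weight \<open>1 / (d + 1)\<close> or \<open>1 / d\<close> at degree \<open>d\<close> in \<open>x\<close> this is integration over a parameter that
  marks the letters \<open>x\<close>.\<close>
lift_definition weigh :: "(nat \<Rightarrow> 'k::field) \<Rightarrow> 'k assoc \<Rightarrow> 'k assoc" is
  "\<lambda>c a w. c (count_list w X) * a w" .

lemma coeff_weigh [simp]: "coeff (weigh c a) w = c (count_list w X) * coeff a w"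
  by transfer simp

lemma coeff_hom_part: "coeff (hom_part k a) w = (if length w = k then coeff a w else 0)"
  by transfer simp

lemma coeff_mult_nonzeroE:
  assumes "coeff (a * b) w \<noteq> 0"
  obtains u v where "w = u @ v" "coeff a u \<noteq> 0" "coeff b v \<noteq> 0"
proof -
  from assms obtain k where "coeff a (take k w) * coeff b (drop k w) \<noteq> 0"
    unfolding coeff_mult by (meson sum.neutral)
  then show thesis by (intro that[of "take k w" "drop k w"]) auto
qed

lemma lie_word_bihomogeneous:
  "lie_word n a \<Longrightarrow> \<exists>d. \<forall>w. coeff a w \<noteq> 0 \<longrightarrow> length w = n \<and> count_list w X = d"
proof (induction rule: lie_word.induct)
  case (letter l)
  show ?case by (rule exI[of _ "count_list [l] X"]) (simp add: coeff_letter)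
next
  case (bracket m a n b)
  then obtain d e where
    d: "\<And>w. coeff a w \<noteq> 0 \<Longrightarrow> length w = m \<and> count_list w X = d" and
    e: "\<And>w. coeff b w \<noteq> 0 \<Longrightarrow> length w = n \<and> count_list w X = e" by blast
  have "length w = m + n \<and> count_list w X = d + e" if "coeff \<lbrakk>a, b\<rbrakk> w \<noteq> 0" for w
  proof -
    from that have "coeff (a * b) w \<noteq> 0 \<or> coeff (b * a) w \<noteq> 0"
      by (auto simp: lie_bracket_def)
    then show ?thesis
      by (auto elim!: coeff_mult_nonzeroE dest!: d e)
  qed
  then show ?case by blast
qed

abbreviation lie_part :: "nat \<Rightarrow> 'k::field assoc set" where
  "lie_part n \<equiv> assoc.span {u. lie_word n u}"

lemma lie_part_homogeneous:
  fixes a :: "'k::field assoc"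
  assumes "a \<in> lie_part n" and "length w \<noteq> n"
  shows "coeff a w = 0"
proof -
  have "lie_part n \<subseteq> {a :: 'k assoc. \<forall>w. length w \<noteq> n \<longrightarrow> coeff a w = 0}"
    by (rule assoc.span_minimal)
       (use lie_word_bihomogeneous in \<open>fastforce simp: assoc.subspace_def\<close>)+
  with assms show ?thesis by blast
qed

lemma lie_part_subset_lie2: "lie_part n \<subseteq> lie2"
proof
  fix a :: "'k::field assoc" assume a: "a \<in> lie_part n"
  have "hom_part k a = (if k = n then a else 0)" for k
    by (rule assoc_eqI) (auto simp: coeff_hom_part lie_part_homogeneous[OF a])
  with a show "a \<in> lie2"
    by (simp add: lie2_def assoc.span_zero)
qed

text \<open>A Lie word is an eigenvector of every weighting, being homogeneous in \<open>x\<close>.\<close>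
lemma weigh_lie_part:
  assumes "a \<in> lie_part n"
  shows "weigh c a \<in> lie_part n"
proof -
  have "lie_part n \<subseteq> {a. weigh c a \<in> lie_part n}"
  proof (rule assoc.span_minimal)
    show "{u. lie_word n u} \<subseteq> {a. weigh c a \<in> lie_part n}"
    proof clarify
      fix a :: "'a assoc" assume a: "lie_word n a"
      then obtain d where "\<And>w. coeff a w \<noteq> 0 \<Longrightarrow> count_list w X = d"
        using lie_word_bihomogeneous by blast
      then have "weigh c a = scale (c d) a"
        by (intro assoc_eqI) (metis coeff_simps(5) coeff_weigh mult_zero_right)
      with a show "weigh c a \<in> lie_part n"
        by (simp add: assoc.span_base assoc.span_scale)
    qed
    have "weigh c 0 = 0" "\<And>a b. weigh c (a + b) = weigh c a + weigh c b"
         "\<And>r a. weigh c (scale r a) = scale r (weigh c a)"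
      by (rule assoc_eqI; simp add: algebra_simps)+
    then show "assoc.subspace {a. weigh c a \<in> lie_part n}"
      by (simp add: assoc.subspace_def assoc.span_zero assoc.span_add assoc.span_scale)
  qed
  with assms show ?thesis by blast
qed

section \<open>Iterated brackets with the sum of the generators\<close>

fun ad_gens :: "nat \<Rightarrow> 'k::field assoc" where
  "ad_gens 0 = \<^bold>x"
| "ad_gens (Suc n) = \<lbrakk>\<^bold>x + \<^bold>y, ad_gens n\<rbrakk>"

lemma bracket_letter_lie_part:
  fixes a :: "'k::field assoc"
  assumes "a \<in> lie_part n"
  shows "\<lbrakk>letter l, a\<rbrakk> \<in> lie_part (Suc n)"
proof -
  have "lie_part n \<subseteq> {a :: 'k assoc. \<lbrakk>letter l, a\<rbrakk> \<in> lie_part (Suc n)}"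
  proof (rule assoc.span_minimal)
    show "{u. lie_word n u} \<subseteq> {a :: 'k assoc. \<lbrakk>letter l, a\<rbrakk> \<in> lie_part (Suc n)}"
      using lie_word.bracket[OF lie_word.letter] by (auto intro!: assoc.span_base)
    have "\<lbrakk>letter l, 0\<rbrakk> = (0 :: 'k assoc)"
      "\<And>a b :: 'k assoc. \<lbrakk>letter l, a + b\<rbrakk> = \<lbrakk>letter l, a\<rbrakk> + \<lbrakk>letter l, b\<rbrakk>"
      by (simp_all add: lie_bracket_def algebra_simps)
    moreover have "\<lbrakk>letter l, scale r a\<rbrakk> = scale r \<lbrakk>letter l, a\<rbrakk>" for r and a :: "'k assoc"
      by (rule assoc_eqI)
         (simp add: lie_bracket_def coeff_mult sum_distrib_left right_diff_distrib ac_simps)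
    ultimately show "assoc.subspace {a :: 'k assoc. \<lbrakk>letter l, a\<rbrakk> \<in> lie_part (Suc n)}"
      by (simp add: assoc.subspace_def assoc.span_zero assoc.span_add assoc.span_scale)
  qed
  with assms show ?thesis by blast
qed

lemma ad_gens_lie_part: "(ad_gens n :: 'k::field assoc) \<in> lie_part (Suc n)"
proof (induction n)
  case 0
  show ?case using lie_word.letter by (auto intro!: assoc.span_base)
next
  case (Suc n)
  have "(ad_gens (Suc n) :: 'k assoc) = \<lbrakk>\<^bold>x, ad_gens n\<rbrakk> + \<lbrakk>\<^bold>y, ad_gens n\<rbrakk>"
    by (simp add: lie_bracket_def algebra_simps)
  also have "\<dots> \<in> lie_part (Suc (Suc n))"
    using Suc.IH by (intro assoc.span_add bracket_letter_lie_part)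
  finally show ?case .
qed

lemma coeff_bracket_gens:
  assumes "length w = Suc n"
  shows "coeff \<lbrakk>\<^bold>x + \<^bold>y, a\<rbrakk> w = coeff a (tl w) - coeff a (butlast w)"
proof -
  from assms have "w \<noteq> []" by auto
  then have "coeff ((\<^bold>x + \<^bold>y) * a) w = coeff a (tl w)"
    "coeff (a * (\<^bold>x + \<^bold>y)) w = coeff a (butlast w)"
    by (metis list.collapse coeff_gens_mult_Cons)
       (metis \<open>w \<noteq> []\<close> append_butlast_last_id coeff_mult_gens_snoc)
  then show ?thesis by (simp add: lie_bracket_def)
qed

definition is_X :: "letter \<Rightarrow> 'k::field" where
  "is_X l = of_bool (l = X)"

text \<open>Multiplication by \<open>x + y\<close> adds an arbitrary letter, so \<open>ad(x + y)\<close> takes differences of the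
  coefficients at the tail and at the initial part of a word; Pascal's rule then gives the
  expansion of \<open>ad(u) ^ n (x)\<close> as a signed binomial sum of the \<open>u ^ i x u ^ (n - i)\<close>.\<close>
lemma coeff_ad_gens:
  "length w = Suc n \<Longrightarrow>
    coeff (ad_gens n) w = (\<Sum>i\<le>n. (- 1) ^ (n - i) * of_nat (n choose i) * is_X (w ! i))"
proof (induction n arbitrary: w)
  case 0
  then show ?case by (cases w) (auto simp: coeff_letter is_X_def)
next
  case (Suc n)
  let ?c = "\<lambda>n i. (- 1) ^ (n - i) * of_nat (n choose i) :: 'a"
  let ?g = "\<lambda>i. is_X (w ! i) :: 'a"
  have "coeff (ad_gens (Suc n)) w = coeff (ad_gens n) (tl w) - coeff (ad_gens n) (butlast w)"
    using coeff_bracket_gens[OF Suc.prems] by simp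
  also have "coeff (ad_gens n) (tl w) = (\<Sum>i\<le>n. ?c n i * ?g (Suc i))"
    using Suc.prems by (subst Suc.IH) (auto simp: nth_tl)
  also have "coeff (ad_gens n) (butlast w) = (\<Sum>i\<le>n. ?c n i * ?g i)"
    using Suc.prems by (subst Suc.IH) (auto simp: nth_butlast intro!: sum.cong)
  also have "(\<Sum>i\<le>n. ?c n i * ?g i) = ?c n 0 * ?g 0 + (\<Sum>i\<le>n. ?c n (Suc i) * ?g (Suc i))"
    by (subst sum.atMost_Suc_shift[symmetric]) (simp add: binomial_eq_0)
  also have "(\<Sum>i\<le>n. ?c n i * ?g (Suc i)) - (?c n 0 * ?g 0 + (\<Sum>i\<le>n. ?c n (Suc i) * ?g (Suc i)))
      = ?c (Suc n) 0 * ?g 0 + (\<Sum>i\<le>n. (?c n i - ?c n (Suc i)) * ?g (Suc i))"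
    by (simp add: sum_subtractf algebra_simps)
  also have "(\<Sum>i\<le>n. (?c n i - ?c n (Suc i)) * ?g (Suc i))
      = (\<Sum>i\<le>n. ?c (Suc n) (Suc i) * ?g (Suc i))"
  proof (rule sum.cong)
    fix i assume "i \<in> {..n}"
    have "?c n i - ?c n (Suc i) = ?c (Suc n) (Suc i)"
    proof (cases "i = n")
      case False
      then have "n - i = Suc (n - Suc i)" using \<open>i \<in> _\<close> by auto
      then show ?thesis by (simp add: algebra_simps)
    qed (simp add: binomial_eq_0)
    then show "(?c n i - ?c n (Suc i)) * ?g (Suc i) = ?c (Suc n) (Suc i) * ?g (Suc i)"
      by simp
  qed simp
  also have "?c (Suc n) 0 * ?g 0 + \<dots> = (\<Sum>i\<le>Suc n. ?c (Suc n) i * ?g i)"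
    by (rule sum.atMost_Suc_shift[symmetric])
  finally show ?case .
qed

lemma choose_char_minus_1:
  assumes "prime p" "CHAR('k::field) = p" "i < p"
  shows "(of_nat ((p - 1) choose i) :: 'k) = (- 1) ^ i"
  using assms(3)
proof (induction i)
  case (Suc i)
  have "p dvd p choose Suc i"
    using Suc.prems assms(1) by (intro dvd_choose_prime) auto
  moreover have "p choose Suc i = ((p - 1) choose i) + ((p - 1) choose Suc i)"
    using Suc.prems by (cases p) auto
  ultimately have "of_nat ((p - 1) choose i) + of_nat ((p - 1) choose Suc i) = (0 :: 'k)"
    using assms(2) by (metis of_nat_add of_nat_eq_0_iff_char_dvd)
  with Suc show ?case by (simp add: add_eq_0_iff2)
qed simp

lemma choose_char_minus_2:
  assumes "prime p" "CHAR('k::field) = p" "i \<le> p - 2"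
  shows "(of_nat ((p - 2) choose i) :: 'k) = (- 1) ^ i * of_nat (i + 1)"
  using assms(3)
proof (induction i)
  case (Suc i)
  have "p - 1 = Suc (p - 2)" using Suc.prems by simp
  then have "(p - 1) choose Suc i = ((p - 2) choose i) + ((p - 2) choose Suc i)"
    by simp
  moreover have "(of_nat ((p - 1) choose Suc i) :: 'k) = (- 1) ^ Suc i"
    using Suc.prems by (intro choose_char_minus_1 assms(1,2)) auto
  ultimately have "of_nat ((p - 2) choose i) + of_nat ((p - 2) choose Suc i) = ((- 1) ^ Suc i :: 'k)"
    by simp
  then have "(of_nat ((p - 2) choose Suc i) :: 'k) = (- 1) ^ Suc i - of_nat ((p - 2) choose i)"
    by (simp add: eq_diff_eq add.commute)
  also have "of_nat ((p - 2) choose i) = ((- 1) ^ i * of_nat (i + 1) :: 'k)"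
    using Suc by simp
  finally show ?case by (simp add: algebra_simps)
qed simp

lemma coeff_ad_gens_char:
  fixes w :: "letter list"
  assumes "prime p" "p > 2" "CHAR('k::field) = p" "length w = p - 1"
  shows "coeff (ad_gens (p - 2) :: 'k assoc) w = - (\<Sum>i<p - 1. of_nat (i + 1) * is_X (w ! i))"
proof -
  have *: "(- 1) ^ (p - 2 - i) * of_nat ((p - 2) choose i) = - (of_nat (i + 1) :: 'k)"
    if "i \<le> p - 2" for i
  proof -
    have "odd (p - 2)" using assms(1,2) prime_odd_nat by simp
    then have "(- 1) ^ (p - 2 - i) * (- 1) ^ i = (- 1 :: 'k)"
      using that by (metis le_add_diff_inverse2 power_add power_minus_odd power_one)
    with choose_char_minus_2[OF assms(1,3) that] show ?thesis
      by (simp add: mult.assoc[symmetric] del: of_nat_Suc)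
  qed
  have "length w = Suc (p - 2)" using assms by simp
  then have "coeff (ad_gens (p - 2) :: 'k assoc) w
      = (\<Sum>i\<le>p - 2. - of_nat (i + 1) * is_X (w ! i))"
    by (subst coeff_ad_gens) (auto simp only: * atMost_iff intro!: sum.cong)
  also have "{..p - 2} = {..<p - 1}" using assms(2) by auto
  finally show ?thesis by (simp only: mult_minus_left sum_negf)
qed

lemma of_nat_count_X: "of_nat (count_list w X) = (\<Sum>i<length w. is_X (w ! i) :: 'k::field)"
proof (induction w)
  case (Cons l w)
  then show ?case by (simp add: sum.lessThan_Suc_shift is_X_def del: sum.lessThan_Suc)
qed simp

text \<open>The difference of the position sums of the tail and of the initial part of a word telescopes: each
  \<open>x\<close> contributes \<open>1\<close>, the last letter because \<open>- (p - 1) = 1\<close> in the field. This is Jacobson's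
  identity, as \<open>of_nat (count_list w X)\<close> is the coefficient of the sum of all
  \<open>u ^ i x u ^ (p - 1 - i)\<close>.\<close>
lemma coeff_bracket_ad_gens_char:
  fixes w :: "letter list"
  assumes "prime p" "p > 2" "CHAR('k::field) = p" "length w = p"
  shows "coeff \<lbrakk>\<^bold>x + \<^bold>y, ad_gens (p - 2) :: 'k assoc\<rbrakk> w = of_nat (count_list w X)"
proof -
  obtain n where n: "p = Suc n" using assms(2) by (cases p) auto
  let ?g = "\<lambda>i. is_X (w ! i) :: 'k"
  have n1: "of_nat n = (- 1 :: 'k)"
    using assms(3) n of_nat_CHAR[where ?'a = 'k] by (simp add: eq_neg_iff_add_eq_0 add.commute)
  define v :: "'k assoc" where "v = ad_gens (p - 2)"
  have v: "coeff v u = - (\<Sum>i<n. of_nat (i + 1) * is_X (u ! i))"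
    if "length u = n" for u
    using coeff_ad_gens_char[OF assms(1-3), of u] that n by (simp add: v_def)
  have "coeff \<lbrakk>\<^bold>x + \<^bold>y, v\<rbrakk> w
      = - (\<Sum>i<n. of_nat (i + 1) * ?g (Suc i)) + (\<Sum>i<n. of_nat (i + 1) * ?g i)"
    using assms(4) n
    by (subst coeff_bracket_gens[of w n])
       (simp_all add: v nth_tl nth_butlast del: of_nat_Suc)
  also have "(\<Sum>i<n. of_nat (i + 1) * ?g (Suc i)) = (\<Sum>i<Suc n. of_nat i * ?g i)"
    by (subst sum.lessThan_Suc_shift) simp
  also have "- (\<Sum>i<Suc n. of_nat i * ?g i) + (\<Sum>i<n. of_nat (i + 1) * ?g i) = (\<Sum>i<Suc n. ?g i)"
    by (simp add: n1 distrib_right sum.distrib)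
  finally show ?thesis using assms(4) n by (simp add: of_nat_count_X v_def)
qed

section \<open>Cyclic words\<close>

lift_definition rotated :: "'k::field assoc \<Rightarrow> 'k assoc" is "\<lambda>a w. a (rotate1 w)" .

lemma coeff_rotated: "coeff ((rotated ^^ j) a) w = coeff a (rotate j w)"
proof (induction j arbitrary: w)
  case (Suc j)
  have "coeff (rotated b) w = coeff b (rotate1 w)" for b :: "'a assoc"
    by transfer simp
  with Suc show ?case by (simp add: rotate1_rotate_swap)
qed simp

text \<open>Write \<open>a\<close> as \<open>a\<^sub>1 x + a\<^sub>2 y\<close>; moving the last letter to the front gives \<open>x a\<^sub>1 + y a\<^sub>2\<close>, so two
  commutators suffice.\<close>
lemma diff_rotated_commutator:
  assumes "a \<in> assoc_plus"
  shows "a - rotated a \<in> commutator_span"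
proof -
  let ?c = "\<lambda>l. strip_last l a * letter l - letter l * strip_last l a"
  have a: "a = strip_last X a * \<^bold>x + strip_last Y a * \<^bold>y"
    using assms right_presentation_iff[of a "coeff a []" "strip_last X a" "strip_last Y a"]
    by (simp add: assoc_plus_def)
  have "rotated a = \<^bold>x * strip_last X a + \<^bold>y * strip_last Y a"
  proof (rule assoc_eqI)
    fix w
    show "coeff (rotated a) w = coeff (\<^bold>x * strip_last X a + \<^bold>y * strip_last Y a) w"
      using assms coeff_rotated[of 1 a w]
      by (cases w; cases "hd w") (auto simp: assoc_plus_def simp del: coeff_mult_Nil)
  qed
  then have "a - rotated a = ?c X + ?c Y"
    by (subst a) simp
  also have "\<dots> \<in> commutator_span"
    by (intro assoc.span_add assoc.span_base) blast+
  finally show ?thesis .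
qed

text \<open>Modulo commutators \<open>a\<close> equals each of its \<open>n\<close> rotations, hence \<open>n a\<close> equals their sum, which
  vanishes.\<close>
lemma commutator_spanI:
  fixes a :: "'k::field assoc"
  assumes "of_nat n \<noteq> (0 :: 'k)"
    and hom: "\<And>w. length w \<noteq> n \<Longrightarrow> coeff a w = 0"
    and sum: "\<And>w. length w = n \<Longrightarrow> (\<Sum>j<n. coeff a (rotate j w)) = 0"
  shows "a \<in> commutator_span"
proof -
  have "n \<noteq> 0" using assms(1) by (cases n) auto
  then have a: "(rotated ^^ j) a \<in> assoc_plus" for j
    using hom[of "[]"] by (simp add: assoc_plus_def coeff_rotated)
  have diff: "a - (rotated ^^ j) a \<in> commutator_span" for j
  proof (induction j)
    case (Suc j)
    have "a - (rotated ^^ Suc j) a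
        = (a - (rotated ^^ j) a) + ((rotated ^^ j) a - rotated ((rotated ^^ j) a))"
      by simp
    also have "\<dots> \<in> commutator_span"
      by (intro assoc.span_add Suc diff_rotated_commutator a)
    finally show ?case .
  qed (simp add: assoc.span_zero)
  have coeff_sum: "coeff (sum f {..<m}) w = (\<Sum>j<m. coeff (f j) w)"
    for f :: "nat \<Rightarrow> 'k assoc" and m w by (induction m) auto
  have "(\<Sum>j<n. a - (rotated ^^ j) a) = scale (of_nat n) a"
  proof (rule assoc_eqI)
    fix w
    have "coeff (\<Sum>j<n. a - (rotated ^^ j) a) w = (\<Sum>j<n. coeff a w - coeff a (rotate j w))"
      by (simp add: coeff_sum coeff_rotated)
    also have "\<dots> = coeff (scale (of_nat n) a) w"
      by (cases "length w = n") (simp_all add: sum_subtractf sum hom)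
    finally show "coeff (\<Sum>j<n. a - (rotated ^^ j) a) w = coeff (scale (of_nat n) a) w" .
  qed
  moreover have "(\<Sum>j<n. a - (rotated ^^ j) a) \<in> commutator_span"
    by (intro assoc.span_sum diff)
  ultimately have "scale (inverse (of_nat n)) (scale (of_nat n) a) \<in> commutator_span"
    by (simp only: assoc.span_scale)
  with assms(1) show ?thesis by simp
qed

lemma sum_periodic_shift:
  fixes g :: "nat \<Rightarrow> 'k::field"
  assumes "\<And>i. g (i + n) = g i"
  shows "(\<Sum>j<n. g (j + m)) = (\<Sum>j<n. g j)"
proof (induction m)
  case (Suc m)
  have "g m + (\<Sum>j<n. g (j + Suc m)) = (\<Sum>j<Suc n. g (j + m))"
    by (subst sum.lessThan_Suc_shift) simp
  also have "\<dots> = (\<Sum>j<n. g (j + m)) + g m"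
    using assms[of m] by (simp add: add.commute)
  finally show ?case using Suc by simp
qed simp

text \<open>For the indicator \<open>g\<close> of a subset of a cycle of length \<open>n\<close> with \<open>d\<close> elements, the sum adds up the
  cyclic distances from \<open>1\<close> to \<open>n\<close> over all pairs of elements. The distances in the two directions
  between different elements add up to \<open>n\<close>, and the distance of an element to itself counts as
  \<open>n\<close>, so the total is \<open>n (d (d - 1) / 2 + d)\<close>.\<close>
lemma sum_autocorrelation:
  fixes g :: "nat \<Rightarrow> 'k::field"
  assumes per: "\<And>i. g (i + n) = g i" and idem: "\<And>i. g i * g i = g i"
  defines "d \<equiv> \<Sum>j<n. g j"
  shows "2 * (\<Sum>j<n. g j * (\<Sum>i<n. of_nat (i + 1) * g (j + (i + 1)))) = of_nat n * (d * (d + 1))"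
proof -
  \<comment> \<open>The number of pairs at distance \<open>m\<close>; exchanging the pair gives \<open>R (n - m) = R m\<close>.\<close>
  define R where "R m = (\<Sum>j<n. g j * g (j + m))" for m
  have per2: "g (i + n + m) = g (i + m)" for i m
    using per[of "i + m"] by (simp add: ac_simps)
  have R_sym: "R (n - m) = R m" if "m \<le> n" for m
  proof -
    have "R (n - m) = (\<Sum>j<n. g (j + m) * g (j + m + (n - m)))"
      unfolding R_def
      by (rule sum_periodic_shift[symmetric, where g = "\<lambda>j. g j * g (j + (n - m))"])
         (simp add: per per2)
    also have "\<dots> = R m"
      unfolding R_def using that per by (intro sum.cong) (simp_all add: mult.commute)
    finally show ?thesis .
  qed
  have R0: "R 0 = d" by (simp add: R_def d_def idem)
  have R_sum: "(\<Sum>m<n. R m) = d * d"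
  proof -
    have "(\<Sum>m<n. R m) = (\<Sum>j<n. g j * (\<Sum>m<n. g (m + j)))"
      unfolding R_def by (subst sum.swap) (simp add: sum_distrib_left add.commute)
    also have "\<dots> = d * d"
      by (simp add: sum_periodic_shift[where g = g and n = n, OF per] d_def sum_distrib_right)
    finally show ?thesis .
  qed
  have "(\<Sum>j<n. g j * (\<Sum>i<n. of_nat (i + 1) * g (j + (i + 1)))) = (\<Sum>i<n. of_nat (i + 1) * R (i + 1))"
    unfolding R_def sum_distrib_left
    by (subst sum.swap) (intro sum.cong refl; simp only: ac_simps)
  also have "\<dots> = (\<Sum>i\<le>n. of_nat i * R i)"
    by (subst sum.lessThan_Suc_shift[of "\<lambda>i. of_nat i * R i" n, simplified lessThan_Suc_atMost]) simp
  finally have S: "(\<Sum>j<n. g j * (\<Sum>i<n. of_nat (i + 1) * g (j + (i + 1)))) = (\<Sum>i\<le>n. of_nat i * R i)" .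
  have "(\<Sum>i\<le>n. of_nat i * R i) = (\<Sum>i\<le>n. of_nat (n - i) * R (n - i))"
    by (rule sum.nat_diff_reindex[symmetric, of _ "Suc n", simplified lessThan_Suc_atMost, simplified])
  also have "\<dots> = (\<Sum>i\<le>n. of_nat (n - i) * R i)"
    by (intro sum.cong) (simp_all add: R_sym)
  finally have "2 * (\<Sum>i\<le>n. of_nat i * R i)
      = (\<Sum>i\<le>n. of_nat i * R i) + (\<Sum>i\<le>n. of_nat (n - i) * R i)" by simp
  also have "\<dots> = of_nat n * (\<Sum>i\<le>n. R i)"
    unfolding sum.distrib[symmetric] sum_distrib_left
    by (intro sum.cong) (simp_all add: of_nat_diff algebra_simps)
  also have "(\<Sum>i\<le>n. R i) = d * d + d"
    using R_sym[of n] by (simp add: R_sum R0 flip: lessThan_Suc_atMost)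
  finally show ?thesis unfolding S by (simp add: algebra_simps)
qed


lemma count_list_rotate: "count_list (rotate j w) X = count_list w X"
proof (induction j)
  case (Suc j)
  have "count_list (rotate1 v) X = count_list v X" for v
    by (cases v) simp_all
  with Suc show ?case by simp
qed simp

text \<open>The summand is the coefficient of \<open>x \<partial>\<^sub>x A + y \<partial>\<^sub>y B\<close> at a rotation of \<open>w\<close>: the operators
  \<open>x \<partial>\<^sub>x\<close> and \<open>y \<partial>\<^sub>y\<close> move the last letter to the front, and the front letter decides between the
  weights of \<open>A\<close> and \<open>B\<close>. Over all rotations the position sums cancel, because each \<open>x\<close> visits all
  positions and \<open>1 + \<dots> + (p - 1)\<close> is divisible by \<open>p\<close>. Over the rotations that move an \<open>x\<close> they
  add up to \<open>- d (d + 1) / 2\<close> by \<open>sum_autocorrelation\<close>, and this is multiplied by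
  \<open>1 / (d + 1) - 1 / d\<close>.\<close>
lemma sum_rotations:
  fixes w :: "letter list"
  assumes p: "prime p" "p > 2" "CHAR('k::field) = p" "length w = p - 1"
  defines "d \<equiv> of_nat (count_list w X) :: 'k"
  shows "(\<Sum>j<p - 1. - inverse (d + is_X (hd (rotate j w))) *
      coeff (ad_gens (p - 2) :: 'k assoc) (rotate (Suc j) w))
    = (if d = 0 \<or> d + 1 = 0 then 0 else 1 / 2)"
proof -
  define n where "n = p - 1"
  have "n > 0" using p(2) by (simp add: n_def)
  have pn: "p = n + 1" using p(2) by (simp add: n_def)
  have n1: "of_nat n = (- 1 :: 'k)"
    using p(3) of_nat_CHAR[where ?'a = 'k] by (simp add: pn eq_neg_iff_add_eq_0 add.commute)
  have two: "(2 :: 'k) \<noteq> 0"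
  proof
    assume "(2 :: 'k) = 0"
    then have "of_nat 2 = (0 :: 'k)" by simp
    then have "p dvd 2" using p(3) of_nat_eq_0_iff_char_dvd by metis
    then show False using p(2) dvd_imp_le by fastforce
  qed
  define g where "g i = (is_X (w ! (i mod n)) :: 'k)" for i
  define S where "S j = (\<Sum>i<n. of_nat (i + 1) * g (j + (i + 1)))" for j
  define T where "T = (\<Sum>j<n. g j * S j)"
  have len: "length w = n" using p(4) by (simp add: n_def)
  have per: "g (i + n) = g i" and idem: "g i * g i = g i" for i
    by (simp_all add: g_def is_X_def)
  have d: "(\<Sum>j<n. g j) = d"
    by (simp add: d_def of_nat_count_X len g_def)
  have T: "2 * T = - (d * (d + 1))"
    using sum_autocorrelation[where g = g and n = n, OF per idem] by (simp add: T_def S_def d n1 del: of_nat_Suc)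
  have "(\<Sum>j<n. S j) = (\<Sum>i<n. of_nat (i + 1) * (\<Sum>j<n. g (j + (i + 1))))"
    unfolding S_def by (subst sum.swap) (simp only: sum_distrib_left)
  also have "\<dots> = (\<Sum>i<n. of_nat (i + 1)) * d"
    by (simp only: sum_periodic_shift[where g = g and n = n, OF per] d sum_distrib_right)
  also have "(\<Sum>i<n. of_nat (i + 1) :: 'k) = 0"
  proof -
    have "2 * (\<Sum>i<m. of_nat (i + 1) :: 'k) = of_nat m * (of_nat m + 1)" for m
      by (induction m) (simp_all add: algebra_simps)
    from this[of n] two show ?thesis by (simp add: n1)
  qed
  finally have S: "(\<Sum>j<n. S j) = 0" by simp
  have hd: "is_X (hd (rotate j w)) = g j" for j
    using \<open>n > 0\<close> len by (auto simp: hd_rotate_conv_nth g_def)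
  have v: "coeff (ad_gens (p - 2) :: 'k assoc) (rotate (Suc j) w) = - S j" for j
  proof -
    have "coeff (ad_gens (p - 2) :: 'k assoc) (rotate (Suc j) w)
      = - (\<Sum>i<n. of_nat (i + 1) * is_X (rotate (Suc j) w ! i))"
      using coeff_ad_gens_char[OF p(1-3), of "rotate (Suc j) w"] len
      by (simp add: n_def del: rotate_Suc of_nat_Suc)
    also have "(\<Sum>i<n. of_nat (i + 1) * is_X (rotate (Suc j) w ! i)) = S j"
      unfolding S_def g_def
      by (intro sum.cong) (simp_all add: nth_rotate len del: rotate_Suc of_nat_Suc)
    finally show ?thesis .
  qed
  have "(\<Sum>j<n. - inverse (d + is_X (hd (rotate j w))) *
      coeff (ad_gens (p - 2) :: 'k assoc) (rotate (Suc j) w))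
    = (\<Sum>j<n. inverse d * S j + (inverse (d + 1) - inverse d) * (g j * S j))"
  proof (rule sum.cong)
    fix j
    have "g j = 0 \<or> g j = 1" by (simp add: g_def is_X_def)
    then show "- inverse (d + is_X (hd (rotate j w))) * coeff (ad_gens (p - 2)) (rotate (Suc j) w) =
        inverse d * S j + (inverse (d + 1) - inverse d) * (g j * S j)"
      unfolding hd v by (auto simp: algebra_simps)
  qed simp
  also have "\<dots> = (inverse (d + 1) - inverse d) * T"
    unfolding T_def by (simp only: sum.distrib sum_distrib_left[symmetric] S) simp
  also have "\<dots> = (if d = 0 \<or> d + 1 = 0 then 0 else 1 / 2)"
  proof (cases "d = 0 \<or> d + 1 = 0")
    case True
    then have "T = 0" using T two by auto
    then show ?thesis using True by simp
  next
    case False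
    have "T = - (d * (d + 1)) / 2" using T two by (simp add: field_simps)
    moreover have "inverse (d + 1) * (d * (d + 1)) = d" "inverse d * (d * (d + 1)) = d + 1"
      using False by auto
    then have "(inverse (d + 1) - inverse d) * (d * (d + 1)) = - 1"
      by (simp only: left_diff_distrib) simp
    ultimately show ?thesis using False by (metis minus_divide_left minus_minus mult_minus_right times_divide_eq_right)
  qed
  finally show ?thesis by (simp only: n_def)
qed

lemma tr_eqI:
  "a \<in> assoc_plus \<Longrightarrow> b \<in> assoc_plus \<Longrightarrow> a - b \<in> commutator_span \<Longrightarrow> tr a = tr b"
  using tr_tilde_eq_iff[of a b] by (simp add: tr_def)

theorem mainTheorem1:
  fixes p :: nat
  assumes "prime p" and "p > 2" and "CHAR('k::field) = p"
  shows "\<exists>A \<in> (lie2 :: 'k assoc set). \<exists>B \<in> lie2.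
    \<lbrakk>\<^bold>x, A\<rbrakk> + \<lbrakk>\<^bold>y, B\<rbrakk> = \<^bold>x ^ p + \<^bold>y ^ p - (\<^bold>x + \<^bold>y) ^ p \<and>
    tr (\<^bold>x * \<partial>\<^sub>x A + \<^bold>y * \<partial>\<^sub>y B) =
      scale_tr2T (1 / 2) (tr (\<^bold>x ^ (p - 1) + \<^bold>y ^ (p - 1) - (\<^bold>x + \<^bold>y) ^ (p - 1)))"
proof -
  define v :: "'k assoc" where "v = ad_gens (p - 2)"
  \<comment> \<open>The weights are \<open>0\<close> where their denominator vanishes in the field. In \<open>A\<close> this concerns only
    the word \<open>x ^ (p - 1)\<close>, at which \<open>v\<close> vanishes anyway.\<close>
  define c where "c l d = - inverse (of_nat d + is_X l :: 'k)" for l d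
  define A where "A = weigh (c X) v"
  define B where "B = weigh (c Y) v"
  have "Suc (p - 2) = p - 1" using assms(2) by simp
  then have v_lie: "v \<in> lie_part (p - 1)"
    unfolding v_def using ad_gens_lie_part[of "p - 2"] by simp
  then have lie_part: "A \<in> lie_part (p - 1)" "B \<in> lie_part (p - 1)"
    by (simp_all add: A_def B_def weigh_lie_part)
  then have lie: "A \<in> lie2" "B \<in> lie2" using lie_part_subset_lie2 by blast+

  have of_nat_0: "of_nat k = (0 :: 'k) \<longleftrightarrow> k = 0" if "k < p" for k
    using that assms(3) by (metis dvd_imp_le gr_zeroI leD of_nat_0 of_nat_eq_0_iff_char_dvd)
  have all_X: "count_list w X = length w \<longleftrightarrow> w = replicate (length w) X" for w
  proof (induction w)
    case (Cons l w)
    then show ?case using count_le_length[of w X] by (cases l) auto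
  qed simp
  have all_Y: "count_list w X = 0 \<longleftrightarrow> w = replicate (length w) Y" for w
  proof (induction w)
    case (Cons l w)
    then show ?case by (cases l) auto
  qed simp

  \<comment> \<open>Multiplying by \<open>x\<close> raises the degree in \<open>x\<close>, which turns the weight of \<open>A\<close> into that of \<open>B\<close>.\<close>
  have "\<lbrakk>\<^bold>x, A\<rbrakk> + \<lbrakk>\<^bold>y, B\<rbrakk> = weigh (c Y) \<lbrakk>\<^bold>x + \<^bold>y, v\<rbrakk>"
  proof -
    have "letter l * weigh (c l) v = weigh (c Y) (letter l * v)" for l
    proof (rule assoc_eqI)
      fix w
      show "coeff (letter l * weigh (c l) v) w = coeff (weigh (c Y) (letter l * v)) w"
        by (cases w; cases l) (auto simp: c_def is_X_def add.commute simp del: coeff_mult_Nil)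
    qed
    moreover have "weigh (c l) v * letter l = weigh (c Y) (v * letter l)" for l
    proof (rule assoc_eqI)
      fix w
      show "coeff (weigh (c l) v * letter l) w = coeff (weigh (c Y) (v * letter l)) w"
        by (cases w rule: rev_cases; cases l)
           (auto simp: c_def is_X_def add.commute simp del: coeff_mult_Nil)
    qed
    moreover have "weigh f a + weigh f b = weigh f (a + b)" "weigh f a - weigh f b = weigh f (a - b)"
      for f and a b :: "'k assoc"
      by (rule assoc_eqI; simp add: algebra_simps)+
    ultimately show ?thesis
      by (simp add: lie_bracket_def A_def B_def algebra_simps)
  qed
  also have "\<dots> = \<^bold>x ^ p + \<^bold>y ^ p - (\<^bold>x + \<^bold>y) ^ p"
  proof (rule assoc_eqI)
    fix w
    show "coeff (weigh (c Y) \<lbrakk>\<^bold>x + \<^bold>y, v\<rbrakk>) w = coeff (\<^bold>x ^ p + \<^bold>y ^ p - (\<^bold>x + \<^bold>y) ^ p) w"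
    proof (cases "length w = p")
      case True
      define d where "d = count_list w X"
      have w: "w = replicate p X \<longleftrightarrow> d = p" "w = replicate p Y \<longleftrightarrow> d = 0"
        unfolding d_def using True all_X all_Y by auto
      have "d \<le> p" using True count_le_length d_def by metis
      then have "(of_nat d :: 'k) = 0 \<longleftrightarrow> d = p \<or> d = 0"
        using of_nat_0[of d] assms(3) by (cases "d = p") auto
      moreover have "coeff (weigh (c Y) \<lbrakk>\<^bold>x + \<^bold>y, v\<rbrakk>) w = - (inverse (of_nat d) * of_nat d)"
        using coeff_bracket_ad_gens_char[OF assms True]
        by (simp add: v_def c_def is_X_def d_def)
      ultimately show ?thesis
        using assms(2) True w by (auto simp: coeff_letter_power coeff_gens_power)
    next
      case False
      from v_lie have "\<lbrakk>\<^bold>x, v\<rbrakk> + \<lbrakk>\<^bold>y, v\<rbrakk> \<in> lie_part (Suc (p - 1))"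
        by (intro assoc.span_add bracket_letter_lie_part)
      moreover have "\<lbrakk>\<^bold>x, v\<rbrakk> + \<lbrakk>\<^bold>y, v\<rbrakk> = \<lbrakk>\<^bold>x + \<^bold>y, v\<rbrakk>"
        by (simp add: lie_bracket_def algebra_simps)
      ultimately have "coeff \<lbrakk>\<^bold>x + \<^bold>y, v\<rbrakk> w = 0"
        using False assms(2) by (intro lie_part_homogeneous[of _ p]) auto
      then show ?thesis
        using False by (auto simp: coeff_letter_power coeff_gens_power)
    qed
  qed
  finally have eq1: "\<lbrakk>\<^bold>x, A\<rbrakk> + \<lbrakk>\<^bold>y, B\<rbrakk> = \<^bold>x ^ p + \<^bold>y ^ p - (\<^bold>x + \<^bold>y) ^ p" .

  define D where "D = \<^bold>x * \<partial>\<^sub>x A + \<^bold>y * \<partial>\<^sub>y B"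
  define E :: "'k assoc" where "E = \<^bold>x ^ (p - 1) + \<^bold>y ^ (p - 1) - (\<^bold>x + \<^bold>y) ^ (p - 1)"
  have coeff_D: "coeff D w = c (hd w) (count_list w X) * coeff v (rotate1 w)" if "w \<noteq> []" for w
    using that unfolding D_def A_def B_def partial_x_eq partial_y_eq
    by (cases w; cases "hd w") (auto simp: add.commute)
  have D_Nil: "coeff D [] = 0" by (simp add: D_def coeff_letter)
  have coeff_E: "coeff E w = of_bool (w = replicate (p - 1) X) + of_bool (w = replicate (p - 1) Y)
      - of_bool (length w = p - 1)" for w
    by (simp add: E_def coeff_letter_power coeff_gens_power)
  have "D - scale (1 / 2) E \<in> commutator_span"
  proof (rule commutator_spanI[of "p - 1"])
    show "of_nat (p - 1) \<noteq> (0 :: 'k)"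
      using of_nat_0[of "p - 1"] assms(2) by auto
  next
    fix w :: "letter list" assume w: "length w \<noteq> p - 1"
    then have "coeff v (rotate1 w) = 0" by (intro lie_part_homogeneous[OF v_lie]) simp
    then have "coeff D w = 0" using coeff_D D_Nil by (cases "w = []") auto
    then show "coeff (D - scale (1 / 2) E) w = 0"
      using w by (auto simp: coeff_E)
  next
    fix w :: "letter list" assume w: "length w = p - 1"
    let ?d = "count_list w X"
    have rot: "count_list (rotate j w) X = ?d" for j by (rule count_list_rotate)
    have "rotate j w \<noteq> []" for j using w assms(2) by auto
    then have "(\<Sum>j<p - 1. coeff D (rotate j w))
        = (\<Sum>j<p - 1. - inverse (of_nat ?d + is_X (hd (rotate j w))) * coeff v (rotate (Suc j) w))"
      by (intro sum.cong) (simp_all add: coeff_D rot c_def)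
    also have "\<dots> = (if of_nat ?d = (0 :: 'k) \<or> of_nat ?d + 1 = (0 :: 'k) then 0 else 1 / 2)"
      unfolding v_def by (rule sum_rotations[OF assms w])
    also have "of_nat ?d = (0 :: 'k) \<longleftrightarrow> ?d = 0"
      using of_nat_0[of ?d] count_le_length[of w X] w assms(2) by simp
    also have "of_nat ?d + 1 = (0 :: 'k) \<longleftrightarrow> ?d = p - 1"
    proof -
      have "?d + 1 \<le> p" using count_le_length[of w X] w assms(2) by simp
      moreover have "of_nat (?d + 1) = (0 :: 'k) \<longleftrightarrow> ?d + 1 = p"
        using calculation of_nat_0[of "?d + 1"] assms(3)
        by (cases "?d + 1 = p") (simp_all add: of_nat_eq_0_iff_char_dvd del: of_nat_Suc of_nat_add)
      ultimately show ?thesis using assms(2) by (auto simp: add.commute)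
    qed
    finally have D: "(\<Sum>j<p - 1. coeff D (rotate j w)) = (if ?d = 0 \<or> ?d = p - 1 then 0 else 1 / 2)" .
    have "coeff E (rotate j w) = of_bool (?d = p - 1) + of_bool (?d = 0) - 1" for j
      using all_X[of "rotate j w"] all_Y[of "rotate j w"] w by (simp add: coeff_E rot)
    moreover have "of_nat (p - 1) = (- 1 :: 'k)"
      using assms of_nat_CHAR[where ?'a = 'k] by (simp add: of_nat_diff)
    ultimately have E: "(\<Sum>j<p - 1. coeff E (rotate j w)) = 1 - of_bool (?d = p - 1) - of_bool (?d = 0)"
      by simp
    show "(\<Sum>j<p - 1. coeff (D - scale (1 / 2) E) (rotate j w)) = 0"
      using D E assms(2) by (simp add: sum_subtractf sum_divide_distrib[symmetric])
  qed
  moreover have "E \<in> assoc_plus"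
    using assms(2) by (simp add: assoc_plus_def coeff_E)
  moreover have "D \<in> assoc_plus" by (simp add: assoc_plus_def D_Nil)
  ultimately have "tr D = scale_tr2T (1 / 2) (tr E)"
    by (simp add: scale_tr tr_eqI assoc_plus_closed)
  with eq1 lie show ?thesis unfolding D_def E_def by blast
qed

end
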